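(* Let $a\in\mathbb{R}$ and $0\le c<1/2$. Let $F$ be a complex function analytic on an open set containing $\{a\,t(1-t): t\in\mathbb{C},\ 0\le\operatorname{Re}(t)\le 1\}\cup\{a\,t(1-t): t\in\mathbb{C},\ -c\le \operatorname{Re}(t)\le c\}$, and suppose $F(a\,t(1-t))=o\!\left(e^{\pi|t|}/|t|\right)$ uniformly for $0\le\operatorname{Re}(t)\le1$ as $\operatorname{Im}(t)\to\pm\infty$. Then $$\frac{1}{2\pi i}\int_{c-i\infty}^{c+i\infty}\frac{F(a\,t(1-t))}{\cos(\pi t)}\,dt=\frac{F(a/4)}{2\pi}.$$
   Context: The integral over the vertical line $\operatorname{Re}(t)=c$ is understood as $\lim_{R\to\infty}\int_{c-iR}^{c+iR}$. *)

theory Defs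
  imports "HOL-Complex_Analysis.Complex_Analysis" "HOL-Library.Landau_Symbols"
begin

text \<open>
  The integral of \<open>f\<close> along the line \<open>Re t = c\<close>, directed upwards, as the symmetric limit of
  integrals over finite segments. Integrability over the segments is required explicitly because
  \<^const>\<open>contour_integral\<close> is total.
\<close>

definition has_vertical_integral :: "(complex \<Rightarrow> complex) \<Rightarrow> complex \<Rightarrow> real \<Rightarrow> bool" where
  "has_vertical_integral f I c \<longleftrightarrow>
     (\<forall>R>0. f contour_integrable_on linepath (Complex c (-R)) (Complex c R)) \<and>
     ((\<lambda>R. contour_integral (linepath (Complex c (-R)) (Complex c R)) f) \<longlongrightarrow> I) at_top"

definition strip :: "real \<Rightarrow> real \<Rightarrow> complex set" where
  "strip x y = {t. x \<le> Re t \<and> Re t \<le> y}"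

text \<open>
  Convergence \<open>Im t \<rightarrow> \<plusminus>\<infinity>\<close> with \<open>t\<close> confined to the strip; a property holds eventually for this
  filter iff it holds for all \<open>t\<close> in the strip with \<open>\<bar>Im t\<bar> \<ge> T\<close>, for some \<open>T\<close>, so
  Landau symbols with respect to it are uniform in \<open>Re t\<close>.
\<close>

definition strip_ends :: "real \<Rightarrow> real \<Rightarrow> complex filter" where
  "strip_ends x y = inf (filtercomap (\<lambda>t. \<bar>Im t\<bar>) at_top) (principal (strip x y))"

lemma eventually_strip_ends:
  "eventually P (strip_ends x y) \<longleftrightarrow> (\<exists>T. \<forall>t\<in>strip x y. T \<le> \<bar>Im t\<bar> \<longrightarrow> P t)"
  unfolding strip_ends_def eventually_inf_principal eventually_filtercomap_at_top_linorder
  by blast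

end

theory Submission
  imports Defs
begin

text \<open>
  Write \<open>g t = F (a t (1 - t)) / cos (\<pi> t)\<close>. The polynomial \<open>t (1 - t)\<close> is invariant under
  \<open>t \<mapsto> 1 - t\<close> while the cosine changes sign, so \<open>g (1 - t) = - g t\<close>. On the rectangle with
  corners \<open>c - iR\<close> and \<open>1 - c + iR\<close>, which is symmetric about \<open>1/2\<close>, this oddness makes opposite
  sides contribute equally to the contour integral (\<open>contour_integral_odd_reflect\<close>). The only pole
  inside is the simple zero of the cosine at \<open>1/2\<close>, with residue \<open>- F (a/4) / \<pi>\<close>, and Cauchy's
  integral formula evaluates the contour integral to \<open>- 2 i F (a/4)\<close>; halving gives

    left side (upwards) = bottom side (rightwards) + \<open>i F (a/4)\<close>

  exactly, for every \<open>R > 0\<close> (\<open>vertical_integral_odd\<close>). The growth hypothesis on \<open>F\<close>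
  makes \<open>g\<close>, hence the integral over the bottom side, vanish as \<open>R \<rightarrow> \<infinity>\<close>, because
  \<open>\<bar>cos (\<pi> t)\<bar>\<close> is of order \<open>exp (\<pi> \<bar>Im t\<bar>)\<close> (\<open>norm_cos_ge_exp\<close>).
\<close>

section \<open>The reciprocal cosine in the strip\<close>

lemma cos_pi_nonzero:
  fixes w :: complex
  assumes "-1/2 < Re w" "Re w < 3/2" "w \<noteq> 1/2"
  shows "cos (of_real pi * w) \<noteq> 0"
proof
  assume "cos (of_real pi * w) = 0"
  then obtain n :: int where "of_real pi * w = of_real (of_int n * pi) + of_real pi / 2"
    by (auto simp: cos_eq_0)
  hence "of_real pi * w = of_real pi * (of_int n + 1 / 2)"
    by (simp add: algebra_simps)
  hence w: "w = of_int n + 1/2"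
    by (subst (asm) mult_cancel_left) simp
  hence "-1/2 < real_of_int n + 1/2" "real_of_int n + 1/2 < 3/2"
    using assms(1,2) by simp_all
  hence "n = 0" by linarith
  with w assms(3) show False by simp
qed

text \<open>
  Of the two exponentials in the cosine, the larger has modulus \<open>exp \<bar>Im z\<bar>\<close> and the smaller is at
  most \<open>1\<close>, which is at most half of the larger once \<open>\<bar>Im z\<bar> \<ge> 1\<close>.
\<close>
lemma norm_cos_ge_exp:
  fixes z :: complex
  assumes "1 \<le> \<bar>Im z\<bar>"
  shows "exp \<bar>Im z\<bar> / 4 \<le> norm (cos z)"
proof -
  have big: "2 \<le> exp \<bar>Im z\<bar>"
    using exp_ge_add_one_self[of "\<bar>Im z\<bar>"] assms by linarith
  have "\<bar>norm (exp (\<i> * z)) - norm (exp (- (\<i> * z)))\<bar> \<le> norm (exp (\<i> * z) + exp (- (\<i> * z)))"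
    using norm_triangle_ineq3[of "exp (\<i> * z)" "- exp (- (\<i> * z))"] by simp
  also have "\<dots> = 2 * norm (cos z)"
    by (simp add: cos_exp_eq norm_divide)
  finally have "\<bar>exp (- Im z) - exp (Im z)\<bar> \<le> 2 * norm (cos z)"
    by simp
  moreover have "exp \<bar>Im z\<bar> / 2 \<le> \<bar>exp (- Im z) - exp (Im z)\<bar>"
  proof (cases "Im z \<ge> 0")
    case True
    hence "exp (- Im z) \<le> 1" by simp
    thus ?thesis using big True unfolding abs_of_nonneg[OF True] by linarith
  next
    case False
    hence abs: "\<bar>Im z\<bar> = - Im z" and "exp (Im z) \<le> 1" by simp_all
    thus ?thesis using big unfolding abs by linarith
  qed
  ultimately show ?thesis by simp
qed

text \<open>
  The difference quotient of \<open>cos (\<pi> w)\<close> at its simple zero \<open>1/2\<close> has no zero left, so dividing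
  by it is harmless: this splits off the pole in the form required by Cauchy's integral formula.
\<close>
lemma inverse_cos_pole:
  obtains k :: "complex \<Rightarrow> complex"
  where "k holomorphic_on {w. -1/2 < Re w \<and> Re w < 3/2}" "k (1/2) = -1 / of_real pi"
    "\<And>w. w \<noteq> 1/2 \<Longrightarrow> k w / (w - 1/2) = 1 / cos (of_real pi * w)"
proof -
  define U where "U = {w::complex. -1/2 < Re w \<and> Re w < 3/2}"
  define q where "q = (\<lambda>w::complex. if w = 1/2 then deriv (\<lambda>w. cos (of_real pi * w)) (1/2)
      else (cos (of_real pi * w) - cos (of_real pi * (1/2))) / (w - 1/2))"
  have cos_half: "cos (of_real pi * (1/2)) = (0::complex)"
    using cos_of_real_pi_half[where 'a = complex] by simp
  have sin_half: "sin (of_real pi * (1/2)) = (1::complex)"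
    using sin_of_real_pi_half[where 'a = complex] by simp
  have "((\<lambda>w. cos (of_real pi * w)) has_field_derivative
      (- sin (of_real pi * (1/2)) * of_real pi)) (at (1/2::complex))"
    by (auto intro!: derivative_eq_intros)
  hence deriv: "deriv (\<lambda>w::complex. cos (of_real pi * w)) (1/2) = - of_real pi"
    by (simp add: DERIV_imp_deriv sin_half del: times_divide_eq_right)
  have "open U"
    unfolding U_def Collect_conj_eq
    by (intro open_Int open_halfspace_Re_gt open_halfspace_Re_lt)
  hence "q holomorphic_on U"
    unfolding q_def by (intro pole_lemma_open) (auto intro!: holomorphic_intros)
  moreover have "q w \<noteq> 0" if "w \<in> U" for w
    using that cos_pi_nonzero[of w] by (auto simp: q_def U_def deriv cos_half simp del: times_divide_eq_right)
  ultimately have "(\<lambda>w. 1 / q w) holomorphic_on U"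
    by (intro holomorphic_intros)
  moreover have "1 / q (1/2) = -1 / of_real pi"
    by (simp add: q_def deriv)
  moreover have "1 / q w / (w - 1/2) = 1 / cos (of_real pi * w)" if "w \<noteq> 1/2" for w
    using that by (simp add: q_def cos_half del: times_divide_eq_right)
  ultimately show thesis
    using that[of "\<lambda>w. 1 / q w"] unfolding U_def by blast
qed

section \<open>Contour integrals of functions odd about one half\<close>

lemma continuous_on_simple_pole:
  fixes \<phi> g :: "complex \<Rightarrow> complex"
  assumes "\<phi> holomorphic_on A" and "\<And>w. w \<noteq> z \<Longrightarrow> g w = \<phi> w / (w - z)"
  shows "continuous_on (A - {z}) g"
proof -
  have "continuous_on (A - {z}) (\<lambda>w. \<phi> w / (w - z))"
    using holomorphic_on_imp_continuous_on[OF assms(1)]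
    by (intro continuous_intros) (auto intro: continuous_on_subset)
  moreover have "continuous_on (A - {z}) g \<longleftrightarrow> continuous_on (A - {z}) (\<lambda>w. \<phi> w / (w - z))"
    by (rule continuous_on_cong[OF refl], rule assms(2)) blast
  ultimately show ?thesis by blast
qed

lemma contour_integral_odd_reflect:
  assumes "\<And>t. g (1 - t) = - g t"
  shows "contour_integral (linepath (1 - a) (1 - b)) g = contour_integral (linepath a b) g"
proof -
  have "g (linepath (1 - a) (1 - b) x) = - g (linepath a b x)" for x
  proof -
    have "linepath (1 - a) (1 - b) x = 1 - linepath a b x"
      by (simp add: linepath_def algebra_simps scaleR_conv_of_real)
    thus ?thesis by (simp only: assms)
  qed
  thus ?thesis
    by (simp add: contour_integral_integral algebra_simps)
qed

text \<open>
  Twice the claimed identity is Cauchy's integral formula on the rectangle with corners \<open>c - iR\<close> and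
  \<open>1 - c + iR\<close>: reflection in \<open>1/2\<close> carries its top side to its bottom side and its right side to
  the downward left side.
\<close>
lemma vertical_integral_odd:
  fixes c R :: real and g \<phi> :: "complex \<Rightarrow> complex"
  assumes c: "0 \<le> c" "c < 1/2" and R: "R > 0"
    and holo: "\<phi> holomorphic_on strip 0 1"
    and g: "\<And>w. w \<noteq> 1/2 \<Longrightarrow> g w = \<phi> w / (w - 1/2)"
    and odd: "\<And>t. g (1 - t) = - g t"
  shows "contour_integral (linepath (Complex c (-R)) (Complex c R)) g =
           contour_integral (linepath (Complex c (-R)) (Complex (1-c) (-R))) g
             - of_real pi * \<i> * \<phi> (1/2)"
proof -
  define p1 p2 p3 p4 where
    "p1 = Complex c (-R)" and "p2 = Complex (1-c) (-R)" and
    "p3 = Complex (1-c) R" and "p4 = Complex c R"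
  have cont: "continuous_on (strip 0 1 - {1/2}) g"
    using holo g by (rule continuous_on_simple_pole)
  have rect: "rectpath p1 p3 =
      linepath p1 p2 +++ linepath p2 p3 +++ linepath p3 p4 +++ linepath p4 p1"
    by (simp add: rectpath_def Let_def p1_def p2_def p3_def p4_def)
  have half: "1/2 \<in> box p1 p3"
    using c R by (simp add: in_box_complex_iff p1_def p3_def)
  have convex: "convex (strip 0 1)"
    unfolding strip_def Collect_conj_eq
    by (intro convex_Int convex_halfspace_Re_ge convex_halfspace_Re_le)
  have "path_image (rectpath p1 p3) \<subseteq> cbox p1 p3 - box p1 p3"
    using c R by (subst path_image_rectpath_cbox_minus_box) (auto simp: p1_def p3_def)
  moreover have "cbox p1 p3 \<subseteq> strip 0 1"
    using c R by (auto simp: in_cbox_complex_iff strip_def p1_def p3_def)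
  ultimately have img: "path_image (rectpath p1 p3) \<subseteq> strip 0 1 - {1/2}"
    using half by blast
  have "(1/2::complex) \<in> {w. 0 < Re w} \<inter> {w. Re w < 1}" by simp
  moreover have "{w. 0 < Re w} \<inter> {w. Re w < 1} \<subseteq> interior (strip 0 1)"
    by (intro interior_maximal open_Int open_halfspace_Re_gt open_halfspace_Re_lt)
       (auto simp: strip_def)
  ultimately have "1/2 \<in> interior (strip 0 1)" by blast
  hence "((\<lambda>w. \<phi> w / (w - 1/2)) has_contour_integral
      2 * pi * \<i> * winding_number (rectpath p1 p3) (1/2) * \<phi> (1/2)) (rectpath p1 p3)"
    using Cauchy_integral_formula_convex_simple[OF convex holo _ _ img] by simp
  moreover have "winding_number (rectpath p1 p3) (1/2) = 1"
    using half by (rule winding_number_rectpath)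
  ultimately have "((\<lambda>w. \<phi> w / (w - 1/2)) has_contour_integral
      2 * pi * \<i> * \<phi> (1/2)) (rectpath p1 p3)" by simp
  moreover have "\<phi> w / (w - 1/2) = g w" if "w \<in> path_image (rectpath p1 p3)" for w
    by (rule g[symmetric]) (use that img in blast)
  ultimately have "(g has_contour_integral 2 * pi * \<i> * \<phi> (1/2)) (rectpath p1 p3)"
    by (rule has_contour_integral_eq)
  hence whole: "contour_integral (rectpath p1 p3) g = 2 * pi * \<i> * \<phi> (1/2)"
    by (rule contour_integral_unique)
  have segs: "closed_segment p1 p2 \<union> closed_segment p2 p3 \<union> closed_segment p3 p4 \<union>
      closed_segment p4 p1 \<subseteq> strip 0 1 - {1/2}"
    using img unfolding rect by (auto simp: path_image_join)
  have int: "g contour_integrable_on linepath p1 p2" "g contour_integrable_on linepath p2 p3"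
     "g contour_integrable_on linepath p3 p4" "g contour_integrable_on linepath p4 p1"
    using segs by (intro contour_integrable_continuous_linepath continuous_on_subset[OF cont]; blast)+
  have sum: "contour_integral (linepath p1 p2) g + contour_integral (linepath p2 p3) g +
      contour_integral (linepath p3 p4) g + contour_integral (linepath p4 p1) g
      = 2 * pi * \<i> * \<phi> (1/2)"
    using int whole unfolding rect by (simp add: contour_integral_join contour_integrable_joinI add.assoc)
  have reflect: "1 - p1 = p3" "1 - p2 = p4" "1 - p4 = p2"
    by (simp_all add: p1_def p2_def p3_def p4_def complex_eq_iff)
  have "contour_integral (linepath p3 p4) g = contour_integral (linepath p1 p2) g"
    using contour_integral_odd_reflect[of g p1 p2, OF odd] by (simp add: reflect)
  moreover have "contour_integral (linepath p2 p3) g = contour_integral (linepath p4 p1) g"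
    using contour_integral_odd_reflect[of g p4 p1, OF odd] by (simp add: reflect)
  moreover have "contour_integral (linepath p1 p4) g = - contour_integral (linepath p4 p1) g"
    by (rule contour_integral_reverse_linepath, rule continuous_on_subset[OF cont])
       (use segs in \<open>simp add: closed_segment_commute\<close>)
  ultimately have "2 * contour_integral (linepath p1 p4) g =
      2 * (contour_integral (linepath p1 p2) g - of_real pi * \<i> * \<phi> (1/2))"
    using sum by (simp add: algebra_simps)
  thus ?thesis
    unfolding p1_def p2_def p4_def by (subst (asm) mult_cancel_left) simp
qed

section \<open>Decay in the strip and the vertical integral\<close>

text \<open>
  Since \<open>\<bar>t\<bar> \<le> 1 + \<bar>Im t\<bar>\<close> in the strip, replacing \<open>\<bar>t\<bar>\<close> by \<open>\<bar>Im t\<bar>\<close> in the exponent costs a factor of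
  at most \<open>exp \<pi>\<close>, after which the lower bound for the cosine applies.
\<close>
lemma quotient_cos_vanishes:
  fixes h :: "complex \<Rightarrow> complex"
  assumes "h \<in> o[strip_ends 0 1](\<lambda>t. of_real (exp (pi * norm t) / norm t))"
  shows "((\<lambda>t. h t / cos (of_real pi * t)) \<longlongrightarrow> 0) (strip_ends 0 1)"
proof (rule tendstoI)
  fix e :: real assume e: "e > 0"
  \<comment> \<open>\<open>exp pi\<close> is the loss in the exponent, \<open>8 = 4 * 2\<close> the loss in the cosine bound and the
      passage from \<open>e / 2\<close> to a strict inequality\<close>
  define d where "d = e / (8 * exp pi)"
  have d: "d > 0" using e by (simp add: d_def)
  have "\<forall>\<^sub>F t in strip_ends 0 1. norm (h t) \<le> d * norm (of_real (exp (pi * norm t) / norm t) :: complex)"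
    using landau_o.smallD[OF assms d] .
  moreover have "\<forall>\<^sub>F t in strip_ends 0 1. 1 \<le> \<bar>Im t\<bar> \<and> t \<in> strip 0 1"
    unfolding eventually_strip_ends by blast
  ultimately show "\<forall>\<^sub>F t in strip_ends 0 1. dist (h t / cos (of_real pi * t)) 0 < e"
  proof eventually_elim
    case (elim t)
    have im: "1 \<le> \<bar>Im t\<bar>" and "0 \<le> Re t" "Re t \<le> 1" using elim by (auto simp: strip_def)
    have "norm t \<le> 1 + \<bar>Im t\<bar>"
      using cmod_le[of t] \<open>0 \<le> Re t\<close> \<open>Re t \<le> 1\<close> by linarith
    hence "pi * norm t \<le> pi * (1 + \<bar>Im t\<bar>)"
      by (intro mult_left_mono) auto
    hence le: "exp (pi * norm t) \<le> exp pi * exp (pi * \<bar>Im t\<bar>)"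
      by (simp add: distrib_left flip: exp_add)
    have "1 \<le> norm t" using im abs_Im_le_cmod[of t] by linarith
    hence "exp (pi * norm t) / norm t \<le> exp (pi * norm t)"
      by (simp add: divide_le_eq)
    hence "norm (h t) \<le> d * (exp pi * exp (pi * \<bar>Im t\<bar>))"
      using elim(1) le d
      by (smt (verit) mult_left_mono norm_of_real abs_of_nonneg divide_nonneg_nonneg exp_ge_zero norm_ge_zero)
    also have "\<dots> = e / 2 * (exp (pi * \<bar>Im t\<bar>) / 4)"
      by (simp add: d_def)
    also have "\<dots> \<le> e / 2 * norm (cos (of_real pi * t))"
    proof -
      have eq: "\<bar>Im (of_real pi * t)\<bar> = pi * \<bar>Im t\<bar>" by (simp add: abs_mult)
      have "1 * 1 \<le> pi * \<bar>Im t\<bar>"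
        using im pi_ge_two by (intro mult_mono) auto
      hence "exp (pi * \<bar>Im t\<bar>) / 4 \<le> norm (cos (of_real pi * t))"
        using norm_cos_ge_exp[of "of_real pi * t"] unfolding eq by simp
      thus ?thesis using e by (intro mult_left_mono) auto
    qed
    finally have "norm (h t / cos (of_real pi * t)) \<le> e / 2"
      using e by (cases "cos (of_real pi * t) = 0") (simp_all add: norm_divide divide_le_eq)
    thus ?case using e by simp
  qed
qed

lemma bottom_integral_vanishes:
  fixes c :: real and g :: "complex \<Rightarrow> complex"
  assumes c: "0 \<le> c" "c < 1/2"
    and cont: "continuous_on (strip 0 1 - {1/2}) g"
    and lim: "(g \<longlongrightarrow> 0) (strip_ends 0 1)"
  shows "((\<lambda>R. contour_integral (linepath (Complex c (-R)) (Complex (1-c) (-R))) g) \<longlongrightarrow> 0) at_top"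
proof (rule tendstoI)
  fix e :: real assume e: "e > 0"
  have "\<forall>\<^sub>F t in strip_ends 0 1. dist (g t) 0 < e / 2"
    using lim e by (intro tendstoD) auto
  then obtain T where T: "\<And>t. t \<in> strip 0 1 \<Longrightarrow> T \<le> \<bar>Im t\<bar> \<Longrightarrow> norm (g t) < e / 2"
    unfolding eventually_strip_ends by auto
  have "\<forall>\<^sub>F R in at_top. R > max T 0" by (rule eventually_gt_at_top)
  thus "\<forall>\<^sub>F R in at_top.
      dist (contour_integral (linepath (Complex c (-R)) (Complex (1-c) (-R))) g) 0 < e"
  proof eventually_elim
    case (elim R)
    have seg: "t \<in> strip 0 1 - {1/2} \<and> Im t = -R"
      if t: "t \<in> closed_segment (Complex c (-R)) (Complex (1-c) (-R))" for t
    proof -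
      have "t \<in> strip 0 1" and "Im t = -R"
        using t c
        by (auto simp: closed_segment_same_Im closed_segment_eq_real_ivl strip_def split: if_splits)
      moreover from this have "t \<noteq> 1/2" using elim by force
      ultimately show ?thesis by blast
    qed
    have "norm (contour_integral (linepath (Complex c (-R)) (Complex (1-c) (-R))) g)
        \<le> e / 2 * norm (Complex (1-c) (-R) - Complex c (-R))"
    proof (rule contour_integral_bound_linepath)
      show "g contour_integrable_on linepath (Complex c (-R)) (Complex (1-c) (-R))"
        using seg by (intro contour_integrable_continuous_linepath continuous_on_subset[OF cont]) blast
      show "norm (g t) \<le> e / 2" if "t \<in> closed_segment (Complex c (-R)) (Complex (1-c) (-R))" for t
        using seg[OF that] T[of t] elim by auto
    qed (use e in auto)
    also have "Complex (1-c) (-R) - Complex c (-R) = of_real (1 - 2 * c)"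
      by (simp add: complex_eq_iff)
    also have "e / 2 * norm (of_real (1 - 2 * c) :: complex) \<le> e / 2 * 1"
      using c e by (intro mult_left_mono) (auto simp: norm_of_real simp del: of_real_diff)
    finally show ?case using e by simp
  qed
qed

theorem mainTheorem2:
  fixes a c :: real and F :: "complex \<Rightarrow> complex" and S :: "complex set"
  assumes "0 \<le> c" and "c < 1/2"
    and "open S" and "F analytic_on S"
    and "(\<lambda>t. of_real a * t * (1 - t)) ` strip 0 1 \<union>
         (\<lambda>t. of_real a * t * (1 - t)) ` strip (-c) c \<subseteq> S"
    and "(\<lambda>t. F (of_real a * t * (1 - t))) \<in>
           o[strip_ends 0 1](\<lambda>t. of_real (exp (pi * norm t) / norm t))"
  shows "\<exists>I. has_vertical_integral
               (\<lambda>t. F (of_real a * t * (1 - t)) / cos (of_real pi * t)) I c \<and>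
             1 / (2 * of_real pi * \<i>) * I = F (of_real a / 4) / (2 * of_real pi)"
proof -
  define h where "h = (\<lambda>t. F (of_real a * t * (1 - t)))"
  define g where "g = (\<lambda>t. h t / cos (of_real pi * t))"
  obtain k where k: "k holomorphic_on {w. -1/2 < Re w \<and> Re w < 3/2}"
      and k_half: "k (1/2) = -1 / of_real pi"
      and k_cos: "\<And>w. w \<noteq> 1/2 \<Longrightarrow> k w / (w - 1/2) = 1 / cos (of_real pi * w)"
    using inverse_cos_pole by blast
  define \<phi> where "\<phi> = (\<lambda>w. h w * k w)"
  have "F \<circ> (\<lambda>t. of_real a * t * (1 - t)) holomorphic_on strip 0 1"
    using assms(5) analytic_imp_holomorphic[OF assms(4)]
    by (intro holomorphic_on_compose_gen[where t = S]) (auto intro!: holomorphic_intros)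
  hence h: "h holomorphic_on strip 0 1"
    by (simp add: h_def o_def)
  have \<phi>: "\<phi> holomorphic_on strip 0 1"
    unfolding \<phi>_def
    by (intro holomorphic_on_mult h holomorphic_on_subset[OF k]) (auto simp: strip_def)
  have g_\<phi>: "g w = \<phi> w / (w - 1/2)" if "w \<noteq> 1/2" for w
  proof -
    have "\<phi> w / (w - 1/2) = h w * (k w / (w - 1/2))"
      by (simp add: \<phi>_def)
    also have "\<dots> = g w"
      unfolding k_cos[OF that] by (simp add: g_def)
    finally show ?thesis ..
  qed
  have odd: "g (1 - t) = - g t" for t
  proof -
    have "cos (of_real pi * (1 - t)) = - cos (of_real pi * t)"
      by (simp add: right_diff_distrib cos_diff flip: sin_of_real cos_of_real)
    moreover have "h (1 - t) = h t" by (simp add: h_def mult.commute mult.left_commute)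
    ultimately show ?thesis by (simp add: g_def)
  qed
  have cont: "continuous_on (strip 0 1 - {1/2}) g"
    using \<phi> g_\<phi> by (rule continuous_on_simple_pole)
  have "(g \<longlongrightarrow> 0) (strip_ends 0 1)"
    unfolding g_def by (rule quotient_cos_vanishes) (use assms(6) in \<open>simp add: h_def\<close>)
  hence "((\<lambda>R. contour_integral (linepath (Complex c (-R)) (Complex (1-c) (-R))) g
            - of_real pi * \<i> * \<phi> (1/2)) \<longlongrightarrow> 0 - of_real pi * \<i> * \<phi> (1/2)) at_top"
    by (intro tendsto_diff tendsto_const bottom_integral_vanishes assms(1,2) cont)
  moreover have "\<forall>\<^sub>F R in at_top.
      contour_integral (linepath (Complex c (-R)) (Complex (1-c) (-R))) g - of_real pi * \<i> * \<phi> (1/2)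
        = contour_integral (linepath (Complex c (-R)) (Complex c R)) g"
    using eventually_gt_at_top[of 0]
    by eventually_elim (rule vertical_integral_odd[where g = g, OF assms(1,2) _ \<phi> g_\<phi> odd, symmetric])
  moreover have "0 - of_real pi * \<i> * \<phi> (1/2) = \<i> * F (of_real a / 4)"
    by (simp add: \<phi>_def k_half h_def field_simps)
  ultimately have lim: "((\<lambda>R. contour_integral (linepath (Complex c (-R)) (Complex c R)) g)
      \<longlongrightarrow> \<i> * F (of_real a / 4)) at_top"
    using Lim_transform_eventually by fastforce
  have "g contour_integrable_on linepath (Complex c (-R)) (Complex c R)" for R
  proof -
    have "closed_segment (Complex c (-R)) (Complex c R) \<subseteq> {t. Re t = c}"
      by (auto simp: closed_segment_same_Re)
    also have "\<dots> \<subseteq> strip 0 1 - {1/2}"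
      using assms(1,2) by (auto simp: strip_def)
    finally show ?thesis
      by (intro contour_integrable_continuous_linepath continuous_on_subset[OF cont])
  qed
  with lim have "has_vertical_integral g (\<i> * F (of_real a / 4)) c"
    by (simp add: has_vertical_integral_def)
  thus ?thesis
    unfolding g_def h_def by (intro exI[of _ "\<i> * F (of_real a / 4)"]) simp
qed

end
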